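(* Let $T$ be a posinormal or quasiposinormal operator on a complex Hilbert space such that $0$ is not a limit point of the spectrum $\sigma(T)$ and $T|_{\mathcal{N}(T)^\perp}$ is isoloid. Then the range $\mathcal{R}(T)$ of $T$ is closed.
   Context: An operator is a bounded linear transformation of a Hilbert space into itself. $\mathcal{N}(T)$ and $\mathcal{R}(T)$ denote the kernel and range of $T$. An operator $T$ is posinormal if $\mathcal{R}(T)\subseteq\mathcal{R}(T^* )$, and quasiposinormal if $\mathcal{R}(T)^-\subseteq\mathcal{R}(T^* )^-$ (equivalently $\mathcal{N}(T)\subseteq\mathcal{N}(T^* )$), where $^-$ denotes closure. In either case $\mathcal{N}(T)$ reduces $T$, so $T|_{\mathcal{N}(T)^\perp}$ is an operator on $\mathcal{N}(T)^\perp$. An operator is isoloid if every isolated point of its spectrum is an eigenvalue. *)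

theory Defs
  imports "HOL-Analysis.Analysis"
begin

class complex_vector = real_vector +
  fixes scaleC :: "complex \<Rightarrow> 'a \<Rightarrow> 'a"  (infixr \<open>*\<^sub>C\<close> 75)
  assumes scaleC_add_right: "a *\<^sub>C (x + y) = a *\<^sub>C x + a *\<^sub>C y"
    and scaleC_add_left: "(a + b) *\<^sub>C x = a *\<^sub>C x + b *\<^sub>C x"
    and scaleC_scaleC: "a *\<^sub>C b *\<^sub>C x = (a * b) *\<^sub>C x"
    and scaleC_one: "1 *\<^sub>C x = x"
    and scaleR_scaleC: "scaleR r x = complex_of_real r *\<^sub>C x"

text \<open>The inner product is linear in its first argument.\<close>

class complex_inner = complex_vector + real_normed_vector +
  fixes cinner :: "'a \<Rightarrow> 'a \<Rightarrow> complex"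
  assumes cinner_commute: "cinner x y = cnj (cinner y x)"
    and cinner_add_left: "cinner (x + y) z = cinner x z + cinner y z"
    and cinner_scaleC_left: "cinner (a *\<^sub>C x) y = a * cinner x y"
    and cinner_ge_zero: "0 \<le> Re (cinner x x)"
    and cinner_eq_zero_iff: "cinner x x = 0 \<longleftrightarrow> x = 0"
    and norm_eq_sqrt_cinner: "norm x = sqrt (Re (cinner x x))"

class complex_hilbert_space = complex_inner + banach

text \<open>
  Operators on a closed complex subspace \<open>M\<close> of the ambient Hilbert space are
  represented by functions on the whole type of which only the values on \<open>M\<close>
  matter.  The notions with suffix \<open>_on\<close> below thus describe the restriction of
  \<open>T\<close> to \<open>M\<close>; operators on the whole space are the case \<open>M = UNIV\<close>.
\<close>

definition operator_on :: "'a::complex_inner set \<Rightarrow> ('a \<Rightarrow> 'a) \<Rightarrow> bool" where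
  "operator_on M T \<longleftrightarrow>
     (\<forall>x\<in>M. T x \<in> M) \<and>
     (\<forall>x\<in>M. \<forall>y\<in>M. T (x + y) = T x + T y) \<and>
     (\<forall>c. \<forall>x\<in>M. T (c *\<^sub>C x) = c *\<^sub>C T x) \<and>
     (\<exists>K. \<forall>x\<in>M. norm (T x) \<le> norm x * K)"

lemma operator_on_UNIV_iff:
  "operator_on UNIV T \<longleftrightarrow> bounded_linear T \<and> (\<forall>c x. T (c *\<^sub>C x) = c *\<^sub>C T x)"
  by (auto simp: operator_on_def bounded_linear_def bounded_linear_axioms_def
      linear_iff scaleR_scaleC)

definition spectrum_on :: "'a::complex_inner set \<Rightarrow> ('a \<Rightarrow> 'a) \<Rightarrow> complex set" where
  "spectrum_on M T =
     {c. \<not> (\<exists>S. operator_on M S \<and>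
              (\<forall>x\<in>M. S (T x - c *\<^sub>C x) = x \<and> T (S x) - c *\<^sub>C S x = x))}"

definition eigenvalue_on :: "'a::complex_inner set \<Rightarrow> ('a \<Rightarrow> 'a) \<Rightarrow> complex \<Rightarrow> bool" where
  "eigenvalue_on M T c \<longleftrightarrow> (\<exists>x\<in>M. x \<noteq> 0 \<and> T x = c *\<^sub>C x)"

definition isoloid_on :: "'a::complex_inner set \<Rightarrow> ('a \<Rightarrow> 'a) \<Rightarrow> bool" where
  "isoloid_on M T \<longleftrightarrow>
     (\<forall>c. c isolated_in spectrum_on M T \<longrightarrow> eigenvalue_on M T c)"

definition null_space :: "('a \<Rightarrow> 'b::zero) \<Rightarrow> 'a set" where
  "null_space T = {x. T x = 0}"

definition orthocomplement :: "'a::complex_inner set \<Rightarrow> 'a set" where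
  "orthocomplement A = {y. \<forall>x\<in>A. cinner y x = 0}"

text \<open>
  The description below determines at most one function; for an operator on a
  Hilbert space one exists, by the Riesz representation theorem.
\<close>

definition cadjoint :: "('a::complex_inner \<Rightarrow> 'a) \<Rightarrow> 'a \<Rightarrow> 'a" where
  "cadjoint T = (THE S. \<forall>x y. cinner (T x) y = cinner x (S y))"

lemma cadjoint_eqI:
  assumes S: "\<And>x y. cinner (T x) y = cinner x (S y)"
  shows "cadjoint T = S"
  unfolding cadjoint_def
proof (rule the_equality)
  fix S' assume S': "\<forall>x y. cinner (T x) y = cinner x (S' y)"
  show "S' = S"
  proof
    fix y
    let ?d = "S' y - S y"
    have "cinner ?d (S' y) = cinner ?d (S y)"
      using S S' by metis
    then have "cinner (S' y) ?d = cinner (S y) ?d"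
      by (metis cinner_commute)
    moreover have "cinner (S' y) ?d = cinner ?d ?d + cinner (S y) ?d"
      using cinner_add_left[of ?d "S y" ?d] by simp
    ultimately show "S' y = S y"
      by (simp add: cinner_eq_zero_iff)
  qed
qed (use S in simp)

definition posinormal :: "('a::complex_inner \<Rightarrow> 'a) \<Rightarrow> bool" where
  "posinormal T \<longleftrightarrow> range T \<subseteq> range (cadjoint T)"

definition quasiposinormal :: "('a::complex_inner \<Rightarrow> 'a) \<Rightarrow> bool" where
  "quasiposinormal T \<longleftrightarrow> closure (range T) \<subseteq> closure (range (cadjoint T))"

end

theory Submission
  imports Defs
begin

text \<open>
  Let \<open>M\<close> be the orthogonal complement of the kernel \<open>N\<close> of \<open>T\<close>.  The range of the
  adjoint lies in the closed set \<open>M\<close>, so either form of posinormality puts the range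
  of \<open>T\<close> inside \<open>M\<close> (\<open>range_subset_orthocomplement_null_space\<close>).  Thus \<open>T\<close> is the
  direct sum of \<open>0\<close> on \<open>N\<close> and its restriction to \<open>M\<close>, and the spectrum of the
  restriction exceeds that of \<open>T\<close> at most by the point \<open>0\<close>
  (\<open>spectrum_on_orthocomplement_null_space\<close>).  Hence \<open>0\<close> is not a limit point of the
  spectrum of the restriction.  If \<open>0\<close> belonged to that spectrum, it would be isolated
  in it, hence an eigenvalue by isoloidness; but the restriction is injective, because
  \<open>N\<close> and \<open>M\<close> meet only in \<open>0\<close>.  So the restriction is invertible, in particular onto
  \<open>M\<close>, and the range of \<open>T\<close> is the closed set \<open>M\<close>.

  Two classical facts about Hilbert spaces carry this argument: the space is the sum of
  a closed subspace and its orthogonal complement (\<open>orthogonal_decomposition\<close>, by the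
  closest point property), and every bounded linear functional is an inner product with
  a fixed vector (\<open>Riesz_representation\<close>).  The second is what makes the adjoint satisfy
  its defining identity.
\<close>

section \<open>Geometry of a complex inner product\<close>

lemma cinner_add_right: "cinner x (y + z) = cinner x y + cinner x z"
  by (metis cinner_commute cinner_add_left complex_cnj_add)

lemma cinner_scaleC_right: "cinner x (a *\<^sub>C y) = cnj a * cinner x y"
  by (metis cinner_commute cinner_scaleC_left complex_cnj_mult)

lemma cinner_zero_left [simp]: "cinner 0 x = 0"
  using cinner_add_left[of 0 0 x] by simp

lemma cinner_diff_left: "cinner (x - y) z = cinner x z - cinner y z"
  using cinner_add_left[of "x - y" y z] by simp

lemma cinner_diff_right: "cinner x (y - z) = cinner x y - cinner x z"
  using cinner_add_right[of x "y - z" z] by simp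

lemma cinner_self_eq_norm: "cinner x x = complex_of_real ((norm x)\<^sup>2)"
proof (rule complex_eqI)
  show "Re (cinner x x) = Re (complex_of_real ((norm x)\<^sup>2))"
    using cinner_ge_zero[of x] by (simp add: norm_eq_sqrt_cinner)
  have "Im (cinner x x) = - Im (cinner x x)"
    by (metis cinner_commute cnj.simps(2))
  then show "Im (cinner x x) = Im (complex_of_real ((norm x)\<^sup>2))"
    by simp
qed

text \<open>
  Pythagoras for the projection of \<open>x\<close> to the line spanned by \<open>y\<close>.  Nonnegativity of
  the left-hand side gives the Cauchy--Schwarz inequality; that it falls strictly below
  the squared norm of \<open>x\<close> unless \<open>x\<close> and \<open>y\<close> are orthogonal gives the orthogonality
  of closest points.
\<close>

lemma norm_diff_projection:
  assumes "y \<noteq> 0"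
  shows "(norm (x - (cinner x y / cinner y y) *\<^sub>C y))\<^sup>2 =
    (norm x)\<^sup>2 - (cmod (cinner x y))\<^sup>2 / (norm y)\<^sup>2"
proof -
  define a where "a = cinner x y / cinner y y"
  have yy: "cinner y y \<noteq> 0"
    using assms cinner_eq_zero_iff by blast
  have yx: "cinner y x = cnj (cinner x y)"
    by (rule cinner_commute)
  have "cinner (x - a *\<^sub>C y) (a *\<^sub>C y) = 0"
    using yy by (simp add: a_def cinner_diff_left cinner_scaleC_left cinner_scaleC_right)
  then have "cinner (x - a *\<^sub>C y) (x - a *\<^sub>C y) = cinner (x - a *\<^sub>C y) x"
    by (simp add: cinner_diff_right)
  also have "\<dots> = cinner x x - cinner x y * cnj (cinner x y) / cinner y y"
    by (simp add: cinner_diff_left cinner_scaleC_left a_def yx)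
  also have "\<dots> = complex_of_real ((norm x)\<^sup>2 - (cmod (cinner x y))\<^sup>2 / (norm y)\<^sup>2)"
    by (simp only: cinner_self_eq_norm complex_norm_square[symmetric] of_real_diff of_real_divide)
  finally have "(norm (x - a *\<^sub>C y))\<^sup>2 = (norm x)\<^sup>2 - (cmod (cinner x y))\<^sup>2 / (norm y)\<^sup>2"
    unfolding cinner_self_eq_norm of_real_eq_iff .
  then show ?thesis
    by (simp only: a_def)
qed

lemma Cauchy_Schwarz_cinner: "cmod (cinner x y) \<le> norm x * norm y"
proof (cases "y = 0")
  case True
  then show ?thesis
    using cinner_commute[of x y] by simp
next
  case False
  have "(cmod (cinner x y))\<^sup>2 / (norm y)\<^sup>2 \<le> (norm x)\<^sup>2"
    using norm_diff_projection[OF False, of x]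
      zero_le_power2[of "norm (x - (cinner x y / cinner y y) *\<^sub>C y)"] by linarith
  then have "(cmod (cinner x y))\<^sup>2 \<le> (norm x * norm y)\<^sup>2"
    using False by (simp add: field_simps power_mult_distrib)
  then show ?thesis
    by (rule power2_le_imp_le) simp
qed

lemma bounded_linear_cinner_left: "bounded_linear (\<lambda>x. cinner x y)"
  by (rule bounded_linear_intro[where K = "norm y"])
    (simp_all add: cinner_add_left scaleR_scaleC cinner_scaleC_left Cauchy_Schwarz_cinner scaleR_conv_of_real)

lemma parallelogram_law_cinner:
  fixes x y :: "'a::complex_inner"
  shows "(norm (x + y))\<^sup>2 + (norm (x - y))\<^sup>2 = 2 * (norm x)\<^sup>2 + 2 * (norm y)\<^sup>2"
proof -
  have "cinner (x + y) (x + y) + cinner (x - y) (x - y) = 2 * cinner x x + 2 * cinner y y"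
    by (simp add: cinner_add_left cinner_add_right cinner_diff_left cinner_diff_right)
  then have "complex_of_real ((norm (x + y))\<^sup>2 + (norm (x - y))\<^sup>2) =
      complex_of_real (2 * (norm x)\<^sup>2 + 2 * (norm y)\<^sup>2)"
    by (simp add: cinner_self_eq_norm)
  then show ?thesis
    by (simp only: of_real_eq_iff)
qed

section \<open>Orthogonal decomposition and adjoints\<close>

text \<open>
  A sequence in \<open>M\<close> whose distances from \<open>x\<close> approach the infimum is Cauchy: the midpoint
  of two of its members lies in \<open>M\<close> and so is no closer than the infimum, and the
  parallelogram law then bounds the distance between the two members.
\<close>

lemma closest_point_closed_subspace:
  fixes M :: "'a::complex_hilbert_space set"
  assumes "closed M" and sub: "subspace M"
  obtains p where "p \<in> M" and "\<And>m. m \<in> M \<Longrightarrow> norm (x - p) \<le> norm (x - m)"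
proof -
  define d where "d = (INF m\<in>M. norm (x - m))"
  have bdd: "bdd_below ((\<lambda>m. norm (x - m)) ` M)"
    by (rule bdd_belowI[of _ 0]) auto
  have ne: "M \<noteq> {}"
    using subspace_0[OF sub] by auto
  have d_le: "d \<le> norm (x - m)" if "m \<in> M" for m
    unfolding d_def by (rule cINF_lower[OF bdd that])
  have d0: "0 \<le> d"
    unfolding d_def by (rule cINF_greatest[OF ne]) simp
  have "\<exists>m\<in>M. norm (x - m) < d + inverse (real (Suc n))" for n
  proof -
    have "(INF m\<in>M. norm (x - m)) < d + inverse (real (Suc n))"
      unfolding d_def[symmetric] by simp
    then show ?thesis
      by (subst (asm) cINF_less_iff[OF ne bdd])
  qed
  then obtain s where sM: "\<And>n. s n \<in> M"
    and s_less: "\<And>n. norm (x - s n) < d + inverse (real (Suc n))"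
    by metis
  have lim: "(\<lambda>n. norm (x - s n)) \<longlonglongrightarrow> d"
  proof (rule tendsto_sandwich)
    show "\<forall>\<^sub>F n in sequentially. d \<le> norm (x - s n)"
      by (simp add: d_le sM)
    show "\<forall>\<^sub>F n in sequentially. norm (x - s n) \<le> d + inverse (real (Suc n))"
      using s_less less_imp_le by (intro always_eventually) blast
    show "(\<lambda>n. d + inverse (real (Suc n))) \<longlonglongrightarrow> d"
      by (rule LIMSEQ_inverse_real_of_nat_add)
  qed simp
  have gap: "(norm (s i - s j))\<^sup>2 \<le> 2 * ((norm (x - s i))\<^sup>2 - d\<^sup>2) + 2 * ((norm (x - s j))\<^sup>2 - d\<^sup>2)"
    for i j
  proof -
    have "(1/2) *\<^sub>R (s i + s j) \<in> M"
      by (intro subspace_mul subspace_add sub sM)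
    then have "d \<le> norm (x - (1/2) *\<^sub>R (s i + s j))"
      by (rule d_le)
    moreover have "(x - s i) + (x - s j) = 2 *\<^sub>R (x - (1/2) *\<^sub>R (s i + s j))"
      by (simp add: algebra_simps scaleR_2)
    ultimately have "2 * d \<le> norm ((x - s i) + (x - s j))"
      by simp
    then have "(2 * d)\<^sup>2 \<le> (norm ((x - s i) + (x - s j)))\<^sup>2"
      using d0 by (intro power_mono) auto
    moreover have "(x - s i) - (x - s j) = s j - s i"
      by simp
    ultimately show ?thesis
      using parallelogram_law_cinner[of "x - s i" "x - s j"]
      by (simp add: power_mult_distrib norm_minus_commute)
  qed
  have "Cauchy s"
  proof (rule metric_CauchyI)
    fix e :: real
    assume e: "0 < e"
    have "(\<lambda>n. (norm (x - s n))\<^sup>2 - d\<^sup>2) \<longlonglongrightarrow> d\<^sup>2 - d\<^sup>2"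
      by (intro tendsto_intros lim)
    then have "\<forall>\<^sub>F n in sequentially. (norm (x - s n))\<^sup>2 - d\<^sup>2 < e\<^sup>2 / 4"
      using e by (intro order_tendstoD) auto
    then obtain N where N: "\<And>n. n \<ge> N \<Longrightarrow> (norm (x - s n))\<^sup>2 - d\<^sup>2 < e\<^sup>2 / 4"
      by (auto simp: eventually_sequentially)
    have "dist (s i) (s j) < e" if "i \<ge> N" "j \<ge> N" for i j
    proof -
      have "(norm (s i - s j))\<^sup>2 < e\<^sup>2"
        using gap[of i j] add_strict_mono[OF N[OF that(1)] N[OF that(2)]] by argo
      then show ?thesis
        using e by (simp add: dist_norm power_less_imp_less_base)
    qed
    then show "\<exists>N. \<forall>i\<ge>N. \<forall>j\<ge>N. dist (s i) (s j) < e"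
      by blast
  qed
  then obtain p where p: "s \<longlonglongrightarrow> p"
    using Cauchy_convergent convergent_def by blast
  have "p \<in> M"
    using \<open>closed M\<close> sM p by (rule closed_sequentially)
  moreover have "norm (x - p) \<le> norm (x - m)" if "m \<in> M" for m
  proof -
    have "(\<lambda>n. norm (x - s n)) \<longlonglongrightarrow> norm (x - p)"
      by (intro tendsto_intros p)
    then have "norm (x - p) = d"
      using lim LIMSEQ_unique by blast
    then show ?thesis
      using d_le[OF that] by simp
  qed
  ultimately show thesis
    using that by blast
qed

text \<open>
  Take the closest point \<open>p\<close> to \<open>x\<close>.  If \<open>x - p\<close> had a nonzero inner product with some
  \<open>m\<close> in \<open>M\<close>, moving \<open>p\<close> along \<open>m\<close> would come closer to \<open>x\<close>.  The move is by a
  complex multiple of \<open>m\<close>, hence the assumption of closure under complex scaling.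
\<close>

lemma orthogonal_decomposition:
  fixes M :: "'a::complex_hilbert_space set"
  assumes "closed M" and sub: "subspace M"
    and scaleC: "\<And>c m. m \<in> M \<Longrightarrow> c *\<^sub>C m \<in> M"
  obtains p q where "p \<in> M" and "q \<in> orthocomplement M" and "x = p + q"
proof -
  obtain p where p: "p \<in> M" and closest: "\<And>m. m \<in> M \<Longrightarrow> norm (x - p) \<le> norm (x - m)"
    using closest_point_closed_subspace[OF assms(1,2)] by blast
  have "cinner (x - p) m = 0" if m: "m \<in> M" for m
  proof (cases "m = 0")
    case True
    then show ?thesis
      using cinner_commute[of "x - p" m] by simp
  next
    case False
    define a where "a = cinner (x - p) m / cinner m m"
    have "p + a *\<^sub>C m \<in> M"
      by (intro subspace_add sub p scaleC m)
    then have "norm (x - p) \<le> norm (x - p - a *\<^sub>C m)"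
      using closest by (metis diff_diff_eq)
    then have "(norm (x - p))\<^sup>2 \<le> (norm (x - p - a *\<^sub>C m))\<^sup>2"
      by (simp add: power_mono)
    then have "(cmod (cinner (x - p) m))\<^sup>2 / (norm m)\<^sup>2 \<le> 0"
      using norm_diff_projection[OF False, of "x - p"] unfolding a_def by linarith
    then show ?thesis
      using False by (simp add: divide_le_0_iff)
  qed
  then have "x - p \<in> orthocomplement M"
    by (simp add: orthocomplement_def)
  then show thesis
    using that[OF p, of "x - p"] by simp
qed

lemma orthocomplement_Int_self:
  assumes "x \<in> M" and "x \<in> orthocomplement M"
  shows "x = 0"
  using assms cinner_eq_zero_iff[of x] by (auto simp: orthocomplement_def)

lemma closed_orthocomplement:
  fixes A :: "'a::complex_inner set"
  shows "closed (orthocomplement A)"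
proof -
  have "orthocomplement A = (\<Inter>x\<in>A. {y. cinner y x = 0})"
    by (auto simp: orthocomplement_def)
  moreover have "closed {y. cinner y x = 0}" for x :: 'a
    by (intro closed_Collect_eq continuous_on_const
        linear_continuous_on[OF bounded_linear_cinner_left])
  ultimately show ?thesis
    by auto
qed

text \<open>
  For nonzero \<open>f\<close> the complement of its kernel contains a vector \<open>m\<close> with \<open>f m\<close>
  nonzero, and modulo the kernel every \<open>x\<close> is the multiple \<open>f x / f m\<close> of \<open>m\<close>.  So
  the functionals \<open>f\<close> and \<open>\<lambda>x. cinner x m\<close> are proportional.
\<close>

lemma Riesz_representation:
  fixes f :: "'a::complex_hilbert_space \<Rightarrow> complex"
  assumes f: "bounded_linear f" and f_scaleC: "\<And>c x. f (c *\<^sub>C x) = c * f x"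
  obtains z where "\<And>x. f x = cinner x z"
proof (cases "\<forall>x. f x = 0")
  case True
  have "cinner x 0 = 0" for x :: 'a
    using cinner_commute[of x 0] by simp
  then show thesis
    using that[of 0] True by simp
next
  case False
  interpret f: bounded_linear f by (rule f)
  define K where "K = {x. f x = 0}"
  have K: "closed K" "subspace K" "\<And>c m. m \<in> K \<Longrightarrow> c *\<^sub>C m \<in> K"
    unfolding K_def
    by (auto intro!: closed_Collect_eq continuous_on_const linear_continuous_on f subspaceI
        simp: f.add f.scaleR f.zero f_scaleC)
  obtain x0 where x0: "f x0 \<noteq> 0"
    using False by blast
  obtain n m where n: "n \<in> K" and m: "m \<in> orthocomplement K" and "x0 = n + m"
    using orthogonal_decomposition[OF K] by blast
  then have fm: "f m \<noteq> 0"
    using x0 by (simp add: K_def f.add)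
  then have mm: "cinner m m \<noteq> 0"
    using cinner_eq_zero_iff[of m] f.zero by auto
  define z where "z = cnj (f m / cinner m m) *\<^sub>C m"
  have "f x = cinner x z" for x
  proof -
    have "x - (f x / f m) *\<^sub>C m \<in> K"
      using fm by (simp add: K_def f.diff f_scaleC)
    then have "cinner m (x - (f x / f m) *\<^sub>C m) = 0"
      using m by (simp add: orthocomplement_def)
    then have "cinner (x - (f x / f m) *\<^sub>C m) m = 0"
      using cinner_commute[of "x - (f x / f m) *\<^sub>C m" m] by simp
    then have "cinner x m = f x / f m * cinner m m"
      by (simp add: cinner_diff_left cinner_scaleC_left)
    then show ?thesis
      using fm mm by (simp add: z_def cinner_scaleC_right)
  qed
  then show thesis
    using that by blast
qed

lemma cinner_cadjoint:
  fixes T :: "'a::complex_hilbert_space \<Rightarrow> 'a"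
  assumes "operator_on UNIV T"
  shows "cinner (T x) y = cinner x (cadjoint T y)"
proof -
  have T: "bounded_linear T" "\<And>c x. T (c *\<^sub>C x) = c *\<^sub>C T x"
    using assms by (auto simp: operator_on_UNIV_iff)
  have "\<exists>z. \<forall>x. cinner (T x) y = cinner x z" for y
    by (rule Riesz_representation[where f = "\<lambda>x. cinner (T x) y"])
      (auto simp: T cinner_scaleC_left
        intro: bounded_linear_compose[OF bounded_linear_cinner_left])
  then obtain S where "\<And>x y. cinner (T x) y = cinner x (S y)"
    by metis
  then show ?thesis
    using cadjoint_eqI by metis
qed

section \<open>The restriction to the orthogonal complement of the kernel\<close>

lemma null_space_closed_csubspace:
  assumes "operator_on UNIV T"
  shows "closed (null_space T)" and "subspace (null_space T)"
    and "\<And>c x. x \<in> null_space T \<Longrightarrow> c *\<^sub>C x \<in> null_space T"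
proof -
  have T: "bounded_linear T" and scale: "\<And>c x. T (c *\<^sub>C x) = c *\<^sub>C T x"
    using assms by (auto simp: operator_on_UNIV_iff)
  interpret T: bounded_linear T by (rule T)
  have "c *\<^sub>C 0 = (0::'a)" for c
    using scaleC_add_right[of c 0 "0::'a"] by simp
  then show "closed (null_space T)" "subspace (null_space T)"
    "\<And>c x. x \<in> null_space T \<Longrightarrow> c *\<^sub>C x \<in> null_space T"
    unfolding null_space_def
    by (auto intro!: closed_Collect_eq continuous_on_const linear_continuous_on T subspaceI
        simp: T.add T.scaleR T.zero scale)
qed

text \<open>For \<open>x\<close> in the kernel, the inner product of \<open>x\<close> with \<open>cadjoint T y\<close> is that of \<open>T x = 0\<close> with \<open>y\<close>.\<close>

lemma range_cadjoint_subset_orthocomplement: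
  fixes T :: "'a::complex_hilbert_space \<Rightarrow> 'a"
  assumes "operator_on UNIV T"
  shows "range (cadjoint T) \<subseteq> orthocomplement (null_space T)"
proof -
  have "cinner (cadjoint T y) x = 0" if "T x = 0" for x y
    using cinner_cadjoint[OF assms, of x y] cinner_commute[of "cadjoint T y" x] that by simp
  then show ?thesis
    by (auto simp: orthocomplement_def null_space_def)
qed

text \<open>
  The complement of the kernel contains the closure of the range of the adjoint, which
  is why the two forms of posinormality can be treated alike.
\<close>

lemma range_subset_orthocomplement_null_space:
  fixes T :: "'a::complex_hilbert_space \<Rightarrow> 'a"
  assumes T: "operator_on UNIV T" and "posinormal T \<or> quasiposinormal T"
  shows "range T \<subseteq> orthocomplement (null_space T)"
proof -
  have "range T \<subseteq> closure (range (cadjoint T))"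
    using assms(2) closure_subset[of "range T"] closure_subset[of "range (cadjoint T)"]
    unfolding posinormal_def quasiposinormal_def by blast
  also have "\<dots> \<subseteq> orthocomplement (null_space T)"
    by (intro closure_minimal range_cadjoint_subset_orthocomplement[OF T] closed_orthocomplement)
  finally show ?thesis .
qed

text \<open>
  For \<open>c \<noteq> 0\<close> outside the spectrum of \<open>T\<close>, the inverse \<open>S\<close> of \<open>T - c\<close> also inverts the
  restriction of \<open>T - c\<close> to the complement of the kernel, provided that \<open>S\<close> maps the
  complement into itself.  It does: \<open>T - c\<close> acts as multiplication by \<open>- c\<close> on the
  kernel and maps the complement into itself, so the kernel component of \<open>S x\<close> is
  \<open>- 1 / c\<close> times that of \<open>x\<close>.
\<close>

lemma spectrum_on_orthocomplement_null_space:
  fixes T :: "'a::complex_hilbert_space \<Rightarrow> 'a"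
  assumes T: "operator_on UNIV T" and ran: "range T \<subseteq> orthocomplement (null_space T)"
  shows "spectrum_on (orthocomplement (null_space T)) T \<subseteq> insert 0 (spectrum_on UNIV T)"
proof
  let ?M = "orthocomplement (null_space T)"
  fix c
  assume c: "c \<in> spectrum_on ?M T"
  show "c \<in> insert 0 (spectrum_on UNIV T)"
  proof (rule ccontr)
    assume "c \<notin> insert 0 (spectrum_on UNIV T)"
    then obtain S where c0: "c \<noteq> 0" and S: "operator_on UNIV S"
      and left: "\<And>x. S (T x - c *\<^sub>C x) = x" and right: "\<And>x. T (S x) - c *\<^sub>C S x = x"
      by (auto simp: spectrum_on_def)
    have "S x \<in> ?M" if x: "x \<in> ?M" for x
    proof -
      obtain n m where n: "n \<in> null_space T" and m: "m \<in> ?M" and Sx: "S x = n + m"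
        using orthogonal_decomposition[OF null_space_closed_csubspace[OF T]] by blast
      have "T (S x) = T m"
        using T n by (simp add: Sx operator_on_def null_space_def)
      then have "x = T m - c *\<^sub>C n - c *\<^sub>C m"
        using right[of x] by (simp add: Sx scaleC_add_right diff_diff_eq)
      then have cn: "c *\<^sub>C n = T m - x - c *\<^sub>C m"
        by simp
      \<comment> \<open>The right-hand side consists of members of the complement, so \<open>n\<close> lies in both summands.\<close>
      have "c *\<^sub>C n \<in> ?M"
        using ran x m unfolding cn
        by (auto simp: orthocomplement_def cinner_diff_left cinner_scaleC_left)
      then have "n \<in> ?M"
        using c0 by (simp add: orthocomplement_def cinner_scaleC_left)
      then show ?thesis
        using n m Sx orthocomplement_Int_self[of n "null_space T"] by simp
    qed
    then have "operator_on ?M S"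
      using S by (auto simp: operator_on_def)
    then show False
      using c left right by (auto simp: spectrum_on_def)
  qed
qed

theorem corollary3p4:
  fixes T :: "'a::complex_hilbert_space \<Rightarrow> 'a"
  assumes "operator_on UNIV T"
    and "posinormal T \<or> quasiposinormal T"
    and "\<not> 0 islimpt spectrum_on UNIV T"
    and "isoloid_on (orthocomplement (null_space T)) T"
  shows "closed (range T)"
proof -
  let ?M = "orthocomplement (null_space T)"
  have ran: "range T \<subseteq> ?M"
    using assms(1,2) by (rule range_subset_orthocomplement_null_space)
  have "\<not> 0 islimpt insert 0 (spectrum_on UNIV T)"
    using assms(3) by (simp add: islimpt_insert)
  then have not_limpt: "\<not> 0 islimpt spectrum_on ?M T"
    using spectrum_on_orthocomplement_null_space[OF assms(1) ran] islimpt_subset by blast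
  have zero: "0 *\<^sub>C x = 0" for x :: 'a
    using scaleC_add_left[of 0 0 x] by simp
  have "\<not> eigenvalue_on ?M T 0"
    using orthocomplement_Int_self[of _ "null_space T"]
    by (auto simp: eigenvalue_on_def zero null_space_def)
  then have "\<not> 0 isolated_in spectrum_on ?M T"
    using assms(4) by (auto simp: isoloid_on_def)
  then have "0 \<notin> spectrum_on ?M T"
    using not_limpt by (simp add: isolated_in_islimpt_iff)
  then obtain S where "\<And>x. x \<in> ?M \<Longrightarrow> T (S x) = x"
    by (auto simp: spectrum_on_def zero)
  then have "?M \<subseteq> range T"
    by (metis rangeI subsetI)
  with ran have "range T = ?M"
    by blast
  then show ?thesis
    by (simp add: closed_orthocomplement)
qed

end
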